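(* Let $C : \mathsf{Form} \to \mathsf{Prop}$ be any predicate, $\mathsf{Code}$ any type and $\mathsf{eval} : \mathsf{Code} \to \mathsf{Code} \to \mathsf{Form}$ any function, and assume evaluation completeness: for every function $f : \mathsf{Code} \to \mathsf{Form}$ there exists $c \in \mathsf{Code}$ such that for all $x \in \mathsf{Code}$, $\mathsf{eval}(c,x) \simeq_C f(x)$. Then there exists a formula $B$ with $B \simeq_C \neg B$.
   Context: $\mathsf{Form}$ is the type of closed formulas generated by $A,B ::= \bot \mid A \to B$; $\neg A$ abbreviates $A \to \bot$. For a predicate $C$ on $\mathsf{Form}$, $A \simeq_C B$ means $C(A \to B) \land C(B \to A)$. *)

theory Defs
  imports Main
begin

datatype form =
    Bot  ("\<^bold>\<bottom>")
  | Imp form form  (infixr "\<^bold>\<rightarrow>" 65)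

abbreviation Neg :: "form \<Rightarrow> form"  ("\<^bold>\<not> _" [70] 70) where
  "\<^bold>\<not> A \<equiv> A \<^bold>\<rightarrow> \<^bold>\<bottom>"

definition equiv_under :: "(form \<Rightarrow> bool) \<Rightarrow> form \<Rightarrow> form \<Rightarrow> bool" where
  "equiv_under C A B \<longleftrightarrow> C (A \<^bold>\<rightarrow> B) \<and> C (B \<^bold>\<rightarrow> A)"

definition evaluation_complete ::
    "(form \<Rightarrow> bool) \<Rightarrow> ('code \<Rightarrow> 'code \<Rightarrow> form) \<Rightarrow> bool" where
  "evaluation_complete C eval \<longleftrightarrow>
     (\<forall>f :: 'code \<Rightarrow> form. \<exists>c. \<forall>x. equiv_under C (eval c x) (f x))"

end

theory Submission
  imports Defs
begin

theorem theorem3p4: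
  fixes C :: "form \<Rightarrow> bool"
    and eval :: "'code \<Rightarrow> 'code \<Rightarrow> form"
  assumes "evaluation_complete C eval"
  shows "\<exists>B. equiv_under C B (\<^bold>\<not> B)"
proof -
  \<comment> \<open>Cantor's diagonal argument, as in the liar paradox: completeness is applied to
    the function that negates the diagonal of \<open>eval\<close>, and \<open>c\<close> is a code
    for that function.\<close>
  obtain c where "\<forall>x. equiv_under C (eval c x) (\<^bold>\<not> (eval x x))"
    using assms unfolding evaluation_complete_def by (elim allE[of _ "\<lambda>x. \<^bold>\<not> (eval x x)"]) blast
  \<comment> \<open>Feeding \<open>c\<close> to itself makes the coded value and the diagonal entry
    being negated the same formula, so \<open>eval c c\<close> is a fixed point of negation up to
    \<open>equiv_under C\<close>.\<close>
  then have "equiv_under C (eval c c) (\<^bold>\<not> (eval c c))" ..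
  then show ?thesis ..
qed

end
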